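(* Let $a<b$, $k>0$, let $z:[a,b]\to\mathbb{R}^n$ be an integrable function and let $R\in\mathbb{R}^{n\times n}$ be symmetric positive definite. Then $$\int_a^b e^{2k(u-b)}z^T(u)Rz(u)\,du\ \ge\ \frac1{q_0}\Omega_0^TR\Omega_0+\frac1{q_1}\Omega_1^TR\Omega_1+\frac1{q_2}\Omega_2^TR\Omega_2+\frac1{q_3}\left[\Omega_3-\frac{q_{13}}{q_1}\Omega_1\right]^TR\left[\Omega_3-\frac{q_{13}}{q_1}\Omega_1\right],$$ where $$\Omega_0=\int_a^bz(u)du,\qquad \Omega_1=c_1\int_a^bz(u)du+\int_a^b\int_s^bz(u)\,du\,ds,$$ $$\Omega_2=c_3\int_a^bz(u)du+c_2\int_a^b\int_s^bz(u)\,du\,ds+2\int_a^b\int_s^b\int_u^bz(v)\,dv\,du\,ds,$$ $$\Omega_3=\int_a^bz(u)du+c_4\int_a^{\xi}z(u)du,$$ and the constants $c_1,c_2,c_3,c_4,q_0,q_1,q_2,q_3,q_{13}$ and $\xi$ are those given in the context.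
   Context: With $w=e^{2k(b-a)}$: $$c_1=\frac{b-a}{w-1}-\frac1{2k},$$ $$c_2=-\frac{\frac{w-1}{2k^3}-(b-a)^3-\frac{(b-a)^2}{k}-\frac{b-a}{2k^2}-\frac{(b-a)^3}{w-1}-\frac{(b-a)^2}{k(w-1)}}{\frac{w-1}{4k^2}-(b-a)^2-\frac{(b-a)^2}{w-1}},$$ $$c_3=c_1c_2-\left(\frac1{2k^2}-\frac{(b-a)^2}{w-1}-\frac{b-a}{k(w-1)}\right).$$ The point $\xi\in(a,b)$ is such that $$\int_a^{\xi}\left[(u-a)^2+c_2(u-a)+c_3\right]e^{-2k(u-b)}\,du=0,$$ and $$c_4=-\frac{w-1}{w-e^{-2k(\xi-b)}},\qquad q_0=\frac{w-1}{2k},\qquad q_1=\frac{w-1}{8k^3}-\frac{(b-a)^2}{2k}-\frac{(b-a)^2}{2k(w-1)},$$ $$q_2=\frac{3(w-1)}{4k^5}-\frac{(b-a)^4}{2k}-\frac{(b-a)^3}{k^2}-\frac{3(b-a)^2}{2k^3}-\frac{3(b-a)}{2k^4}-c_2^2q_1-(c_3-c_1c_2)^2q_0,$$ $$q_3=\frac{w-1}{2k}\cdot\frac{e^{-2k(\xi-b)}-1}{w-e^{-2k(\xi-b)}},\qquad q_{13}=\frac{(w-1)(\xi-a)e^{-2k(\xi-b)}}{2k(w-e^{-2k(\xi-b)})}-\frac{b-a}{2k}.$$ *)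

theory Defs
  imports "HOL-Analysis.Analysis"
begin

definition sym_pos_def :: "real ^ 'n ^ 'n \<Rightarrow> bool" where
  "sym_pos_def R \<longleftrightarrow> transpose R = R \<and> (\<forall>x. x \<noteq> 0 \<longrightarrow> 0 < x \<bullet> (R *v x))"

definition quad :: "real ^ 'n ^ 'n \<Rightarrow> real ^ 'n \<Rightarrow> real" where
  "quad R x = x \<bullet> (R *v x)"

definition expw :: "real \<Rightarrow> real \<Rightarrow> real \<Rightarrow> real" where
  "expw a b k = exp (2 * k * (b - a))"

definition c1 :: "real \<Rightarrow> real \<Rightarrow> real \<Rightarrow> real" where
  "c1 a b k = (let w = expw a b k in (b - a) / (w - 1) - 1 / (2 * k))"

definition c2 :: "real \<Rightarrow> real \<Rightarrow> real \<Rightarrow> real" where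
  "c2 a b k = (let w = expw a b k in
     - (((w - 1) / (2 * k ^ 3) - (b - a) ^ 3 - (b - a) ^ 2 / k - (b - a) / (2 * k ^ 2)
          - (b - a) ^ 3 / (w - 1) - (b - a) ^ 2 / (k * (w - 1)))
        / ((w - 1) / (4 * k ^ 2) - (b - a) ^ 2 - (b - a) ^ 2 / (w - 1))))"

definition c3 :: "real \<Rightarrow> real \<Rightarrow> real \<Rightarrow> real" where
  "c3 a b k = (let w = expw a b k in
     c1 a b k * c2 a b k
       - (1 / (2 * k ^ 2) - (b - a) ^ 2 / (w - 1) - (b - a) / (k * (w - 1))))"

text \<open>
  The points admissible as \<open>\<xi>\<close>. This is a predicate on \<open>\<xi>\<close> rather than a choice, so a statement
  assuming it holds for every such point.
\<close>
definition is_xi :: "real \<Rightarrow> real \<Rightarrow> real \<Rightarrow> real \<Rightarrow> bool" where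
  "is_xi a b k \<xi> \<longleftrightarrow> a < \<xi> \<and> \<xi> < b \<and>
     (LINT u:{a..\<xi>}|lebesgue.
        ((u - a) ^ 2 + c2 a b k * (u - a) + c3 a b k) * exp (- 2 * k * (u - b))) = 0"

definition c4 :: "real \<Rightarrow> real \<Rightarrow> real \<Rightarrow> real \<Rightarrow> real" where
  "c4 a b k \<xi> = (let w = expw a b k in - ((w - 1) / (w - exp (- 2 * k * (\<xi> - b)))))"

definition q0 :: "real \<Rightarrow> real \<Rightarrow> real \<Rightarrow> real" where
  "q0 a b k = (let w = expw a b k in (w - 1) / (2 * k))"

definition q1 :: "real \<Rightarrow> real \<Rightarrow> real \<Rightarrow> real" where
  "q1 a b k = (let w = expw a b k in
     (w - 1) / (8 * k ^ 3) - (b - a) ^ 2 / (2 * k) - (b - a) ^ 2 / (2 * k * (w - 1)))"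

definition q2 :: "real \<Rightarrow> real \<Rightarrow> real \<Rightarrow> real" where
  "q2 a b k = (let w = expw a b k in
     3 * (w - 1) / (4 * k ^ 5) - (b - a) ^ 4 / (2 * k) - (b - a) ^ 3 / k ^ 2
       - 3 * (b - a) ^ 2 / (2 * k ^ 3) - 3 * (b - a) / (2 * k ^ 4)
       - (c2 a b k) ^ 2 * q1 a b k - (c3 a b k - c1 a b k * c2 a b k) ^ 2 * q0 a b k)"

definition q3 :: "real \<Rightarrow> real \<Rightarrow> real \<Rightarrow> real \<Rightarrow> real" where
  "q3 a b k \<xi> = (let w = expw a b k in
     (w - 1) / (2 * k)
       * ((exp (- 2 * k * (\<xi> - b)) - 1) / (w - exp (- 2 * k * (\<xi> - b)))))"

definition q13 :: "real \<Rightarrow> real \<Rightarrow> real \<Rightarrow> real \<Rightarrow> real" where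
  "q13 a b k \<xi> = (let w = expw a b k in
     (w - 1) * (\<xi> - a) * exp (- 2 * k * (\<xi> - b)) / (2 * k * (w - exp (- 2 * k * (\<xi> - b))))
       - (b - a) / (2 * k))"

definition Omega0 :: "real \<Rightarrow> real \<Rightarrow> (real \<Rightarrow> real ^ 'n) \<Rightarrow> real ^ 'n" where
  "Omega0 a b z = (LINT u:{a..b}|lebesgue. z u)"

definition Omega1 :: "real \<Rightarrow> real \<Rightarrow> real \<Rightarrow> (real \<Rightarrow> real ^ 'n) \<Rightarrow> real ^ 'n" where
  "Omega1 a b k z =
     c1 a b k *\<^sub>R (LINT u:{a..b}|lebesgue. z u)
     + (LINT s:{a..b}|lebesgue. (LINT u:{s..b}|lebesgue. z u))"

definition Omega2 :: "real \<Rightarrow> real \<Rightarrow> real \<Rightarrow> (real \<Rightarrow> real ^ 'n) \<Rightarrow> real ^ 'n" where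
  "Omega2 a b k z =
     c3 a b k *\<^sub>R (LINT u:{a..b}|lebesgue. z u)
     + c2 a b k *\<^sub>R (LINT s:{a..b}|lebesgue. (LINT u:{s..b}|lebesgue. z u))
     + 2 *\<^sub>R (LINT s:{a..b}|lebesgue. (LINT u:{s..b}|lebesgue. (LINT v:{u..b}|lebesgue. z v)))"

definition Omega3 ::
  "real \<Rightarrow> real \<Rightarrow> real \<Rightarrow> real \<Rightarrow> (real \<Rightarrow> real ^ 'n) \<Rightarrow> real ^ 'n" where
  "Omega3 a b k \<xi> z =
     (LINT u:{a..b}|lebesgue. z u) + c4 a b k \<xi> *\<^sub>R (LINT u:{a..\<xi>}|lebesgue. z u)"

text \<open>
  An integrable \<open>z\<close> need not be square integrable, in which case the integral below is \<open>\<infinity>\<close>; the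
  Bochner integral would then be \<open>0\<close> by convention. Hence the value is taken in \<^typ>\<open>ennreal\<close>. For
  positive definite \<open>R\<close> the integrand is nonnegative, so \<^const>\<open>ennreal\<close> truncates nothing.
\<close>
definition weighted_energy ::
  "real \<Rightarrow> real \<Rightarrow> real \<Rightarrow> real ^ 'n ^ 'n \<Rightarrow> (real \<Rightarrow> real ^ 'n) \<Rightarrow> ennreal" where
  "weighted_energy a b k R z =
     (\<integral>\<^sup>+u\<in>{a..b}. ennreal (exp (2 * k * (u - b)) * quad R (z u)) \<partial>lebesgue)"

end

theory Submission
  imports Defs
begin

text \<open>
  The theorem is Bessel's inequality. Let \<open>\<rho>(u) = exp (- 2 * k * (u - b))\<close>, so that the energy has the
  weight \<open>1 / \<rho>\<close>. Consider the functions
    \<^item> \<open>p\<^sub>0 = 1\<close>,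
    \<^item> \<open>p\<^sub>1 = u - a + c1\<close>,
    \<^item> \<open>p\<^sub>2 = (u - a)\<^sup>2 + c2 (u - a) + c3\<close>,
    \<^item> \<open>p\<^sub>3 = 1 + c4 * indicator {a..\<xi>} u\<close>.

  Interchanging the order of integration in the iterated integrals shows that \<open>Omega0\<close> to \<open>Omega3\<close> are
  the integrals of \<open>p\<^sub>i z\<close> (lemmas \<open>tail_integral_moment\<close>, \<open>has_bochner_integral_trial\<close>).
  For the inner product with weight \<open>\<rho>\<close>, the constants \<open>c1\<close>, \<open>c2\<close>, \<open>c3\<close> are those of the Gram--Schmidt
  process, so \<open>p\<^sub>0\<close>, \<open>p\<^sub>1\<close>, \<open>p\<^sub>2\<close> are orthogonal; \<open>c4\<close> makes \<open>p\<^sub>3\<close> orthogonal to \<open>p\<^sub>0\<close>, and the choice of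
  \<open>\<xi>\<close> makes it orthogonal to \<open>p\<^sub>2\<close>. The numbers \<open>q0\<close>, ..., \<open>q3\<close> are the squared norms and \<open>q13\<close> is
  the inner product of \<open>p\<^sub>1\<close> and \<open>p\<^sub>3\<close>. Hence \<open>p\<^sub>3 - (q13 / q1) p\<^sub>1\<close> completes \<open>p\<^sub>0\<close>, \<open>p\<^sub>1\<close>, \<open>p\<^sub>2\<close> to an
  orthogonal system (lemma \<open>basis_gram\<close>). Its squared norm is \<open>q3 - q13\<^sup>2 / q1 \<le> q3\<close>, so Bessel's
  inequality holds with \<open>1 / q3\<close> as the last factor.

  Since \<open>z\<close> may have infinite energy, Bessel's inequality is not proved in an \<open>L\<^sup>2\<close> space but by
  integrating a pointwise lower bound of the energy density (lemma \<open>weighted_bessel_inequality\<close>).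
\<close>

section \<open>Bessel's inequality for an integrable function\<close>

lemma ennreal_integral_le_nn_integral:
  fixes f :: "'a \<Rightarrow> real"
  assumes "integrable M f"
  shows "ennreal (integral\<^sup>L M f) \<le> (\<integral>\<^sup>+x. ennreal (f x) \<partial>M)"
proof -
  have "integral\<^sup>L M f \<le> integral\<^sup>L M (\<lambda>x. max 0 (f x))"
    using assms by (intro integral_mono) auto
  then have "ennreal (integral\<^sup>L M f) \<le> ennreal (integral\<^sup>L M (\<lambda>x. max 0 (f x)))"
    by (rule ennreal_leI)
  also have "\<dots> = (\<integral>\<^sup>+x. ennreal (max 0 (f x)) \<partial>M)"
    using assms by (intro nn_integral_eq_integral[symmetric]) auto
  also have "\<dots> = (\<integral>\<^sup>+x. ennreal (f x) \<partial>M)"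
    by (simp add: max_def ennreal_neg cong: if_cong) 
       (intro nn_integral_cong, auto simp: ennreal_neg)
  finally show ?thesis .
qed

lemma quad_diff:
  assumes "transpose R = R"
  shows "quad R (x - y) = quad R x - 2 * (y \<bullet> (R *v x)) + quad R y"
proof -
  have "x \<bullet> (R *v y) = y \<bullet> (R *v x)"
    by (metis assms dot_lmul_matrix inner_commute transpose_matrix_vector)
  then show ?thesis
    by (simp add: quad_def matrix_vector_mult_diff_distrib inner_diff_left inner_diff_right)
qed

lemma quad_scaleR: "quad R (c *\<^sub>R x) = c\<^sup>2 * quad R x"
  by (simp add: quad_def matrix_vector_mult_scaleR power2_eq_square)

lemma quad_nonneg: "sym_pos_def R \<Longrightarrow> 0 \<le> quad R x"
  by (cases "x = 0") (auto simp: sym_pos_def_def quad_def less_imp_le)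

text \<open>
  Bessel's inequality for the family \<open>\<rho> * p i\<close>, orthogonal with respect to the weight \<open>1 / \<rho>\<close>.
  The function \<open>z\<close> is integrable against each \<open>p i\<close> but may have infinite energy, so it need not lie
  in the Hilbert space in which this is usually proved. Instead, let \<open>y\<close> be the combination of the
  \<open>p i\<close> with coefficients \<open>\<Omega> i / q i\<close>. Positivity of \<open>R\<close> at \<open>z - \<rho> y\<close> gives the pointwise bound
  \<open>quad R z / \<rho> \<ge> 2 (y \<bullet> R z) - \<rho> quad R y\<close>, whose right-hand side is integrable whether or not the
  left-hand side is, and the integral of which is at least the Bessel sum. Having \<open>G i i \<le> q i\<close> in place
  of equality only weakens the bound.
\<close>
lemma weighted_bessel_inequality:
  fixes z :: "'a \<Rightarrow> real ^ 'n" and p :: "'i \<Rightarrow> 'a \<Rightarrow> real"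
  assumes "finite I" and R: "sym_pos_def R"
    and \<rho>: "\<And>x. x \<in> space M \<Longrightarrow> 0 < \<rho> x"
    and pz: "\<And>i. i \<in> I \<Longrightarrow> has_bochner_integral M (\<lambda>x. p i x *\<^sub>R z x) (\<Omega> i)"
    and gram: "\<And>i j. i \<in> I \<Longrightarrow> j \<in> I \<Longrightarrow> has_bochner_integral M (\<lambda>x. p i x * p j x * \<rho> x) (G i j)"
    and orth: "\<And>i j. i \<in> I \<Longrightarrow> j \<in> I \<Longrightarrow> i \<noteq> j \<Longrightarrow> G i j = 0"
    and le: "\<And>i. i \<in> I \<Longrightarrow> G i i \<le> q i"
  shows "ennreal (\<Sum>i\<in>I. 1 / q i * quad R (\<Omega> i)) \<le> (\<integral>\<^sup>+x. ennreal (quad R (z x) / \<rho> x) \<partial>M)"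
proof -
  define v where "v i = (1 / q i) *\<^sub>R \<Omega> i" for i
  define y where "y x = (\<Sum>i\<in>I. p i x *\<^sub>R v i)" for x
  define f where "f x = 2 * (y x \<bullet> (R *v z x)) - \<rho> x * quad R (y x)" for x
  have "transpose R = R"
    using R by (simp add: sym_pos_def_def)
  have f_le: "f x \<le> quad R (z x) / \<rho> x" if "x \<in> space M" for x
  proof -
    have "0 \<le> quad R (z x - \<rho> x *\<^sub>R y x)"
      by (rule quad_nonneg[OF R])
    then have "\<rho> x * f x \<le> quad R (z x)"
      by (simp add: quad_diff[OF \<open>transpose R = R\<close>] quad_scaleR f_def algebra_simps power2_eq_square)
    then show ?thesis
      using \<rho>[OF that] by (simp add: field_simps)
  qed
  have f_eq: "f x = (\<Sum>i\<in>I. 2 * (v i \<bullet> (R *v (p i x *\<^sub>R z x))))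
      - (\<Sum>i\<in>I. \<Sum>j\<in>I. (p i x * p j x * \<rho> x) * (v i \<bullet> (R *v v j)))" for x
  proof -
    have "y x \<bullet> (R *v z x) = (\<Sum>i\<in>I. v i \<bullet> (R *v (p i x *\<^sub>R z x)))"
      by (simp add: y_def inner_sum_left matrix_vector_mult_scaleR)
    moreover have "quad R (y x) = (\<Sum>i\<in>I. \<Sum>j\<in>I. (p i x * p j x) * (v i \<bullet> (R *v v j)))"
      by (simp add: y_def quad_def inner_sum_left inner_sum_right matrix_vector_mult_scaleR
          linear_sum[OF matrix_vector_mul_linear] sum_distrib_left mult_ac)
        (subst sum.swap, intro sum.cong refl, simp add: mult_ac)
    ultimately show ?thesis
      by (simp add: f_def sum_distrib_left mult_ac)
  qed
  have lin: "has_bochner_integral M (\<lambda>x. v i \<bullet> (R *v (p i x *\<^sub>R z x))) (v i \<bullet> (R *v \<Omega> i))"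
    if "i \<in> I" for i
    by (rule has_bochner_integral_bounded_linear[OF _ pz[OF that]])
       (intro bounded_linear_inner_right_comp matrix_vector_mul_bounded_linear)
  have f_int: "has_bochner_integral M f
      ((\<Sum>i\<in>I. 2 * (v i \<bullet> (R *v \<Omega> i))) - (\<Sum>i\<in>I. \<Sum>j\<in>I. G i j * (v i \<bullet> (R *v v j))))"
    unfolding f_eq
    by (intro has_bochner_integral_diff has_bochner_integral_sum has_bochner_integral_mult_right
        has_bochner_integral_mult_left lin gram)
  have diag: "(\<Sum>j\<in>I. G i j * (v i \<bullet> (R *v v j))) = G i i * quad R (v i)" if "i \<in> I" for i
    proof -
    have "(\<Sum>j\<in>I. G i j * (v i \<bullet> (R *v v j))) = (\<Sum>j\<in>I. if i = j then G i i * quad R (v i) else 0)"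
      using orth[OF that] by (intro sum.cong) (auto simp: quad_def)
    then show ?thesis
      using \<open>finite I\<close> that by simp
  qed
  have "(\<Sum>i\<in>I. 1 / q i * quad R (\<Omega> i)) \<le> (\<Sum>i\<in>I. 2 * (v i \<bullet> (R *v \<Omega> i)) - G i i * quad R (v i))"
  proof (rule sum_mono)
    fix i assume "i \<in> I"
    have "G i i * quad R (v i) \<le> q i * quad R (v i)"
      by (intro mult_right_mono le quad_nonneg R \<open>i \<in> I\<close>)
    also have "\<dots> = 1 / q i * quad R (\<Omega> i)"
      by (simp add: v_def quad_scaleR power2_eq_square)
    also have "\<dots> = v i \<bullet> (R *v \<Omega> i)"
      by (simp add: v_def quad_def)
    finally show "1 / q i * quad R (\<Omega> i) \<le> 2 * (v i \<bullet> (R *v \<Omega> i)) - G i i * quad R (v i)"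
      by (simp add: v_def quad_def)
  qed
  also have "\<dots> = integral\<^sup>L M f"
    using f_int by (simp add: has_bochner_integral_iff sum_subtractf diag)
  finally have "ennreal (\<Sum>i\<in>I. 1 / q i * quad R (\<Omega> i)) \<le> ennreal (integral\<^sup>L M f)"
    by (rule ennreal_leI)
  also have "\<dots> \<le> (\<integral>\<^sup>+x. ennreal (f x) \<partial>M)"
    using f_int by (intro ennreal_integral_le_nn_integral) (simp add: has_bochner_integral_iff)
  also have "\<dots> \<le> (\<integral>\<^sup>+x. ennreal (quad R (z x) / \<rho> x) \<partial>M)"
    by (intro nn_integral_mono ennreal_leI f_le)
  finally show ?thesis .
qed

section \<open>Iterated integrals as integrals against polynomials\<close>

lemma has_bochner_integral_FTC_upto:
  fixes f F :: "real \<Rightarrow> real"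
  assumes "a \<le> t" "t \<le> b"
    and deriv: "\<And>x. (F has_real_derivative f x) (at x)" and cont: "continuous_on UNIV f"
  shows "has_bochner_integral (lebesgue_on {a..b}) (\<lambda>x. indicator {..t} x * f x) (F t - F a)"
proof -
  have "has_bochner_integral lborel (\<lambda>x. f x * indicator {a..t} x) (F t - F a)"
    using assms by (intro has_bochner_integral_FTC_Icc_real) (auto simp: continuous_on_eq_continuous_at)
  then have "has_bochner_integral lebesgue (\<lambda>x. f x * indicator {a..t} x) (F t - F a)"
    by (auto simp: has_bochner_integral_iff integrable_completion integral_completion)
  moreover have "f x * indicator {a..t} x = indicator {a..b} x *\<^sub>R (indicator {..t} x * f x)" for x
    using assms by (auto split: split_indicator)
  ultimately show ?thesis
    by (simp add: has_bochner_integral_restrict_space)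
qed

lemma has_bochner_integral_lebesgue_on_indicator:
  fixes z :: "'b :: euclidean_space \<Rightarrow> 'a :: {banach, second_countable_topology}"
  assumes A: "A \<in> sets lebesgue" and B: "B \<in> sets lebesgue" and z: "integrable (lebesgue_on A) z"
  shows "has_bochner_integral (lebesgue_on A) (\<lambda>u. indicator B u *\<^sub>R z u)
           (LINT u:A \<inter> B|lebesgue. z u)"
proof -
  have "integrable (lebesgue_on A) (\<lambda>u. indicator B u *\<^sub>R z u)"
    using A z integrable_mult_indicator[OF B, of "\<lambda>u. indicator A u *\<^sub>R z u"]
    by (simp add: integrable_restrict_space mult.commute)
  then show ?thesis
    using A by (simp add: has_bochner_integral_iff integral_restrict_space set_lebesgue_integral_def
        indicator_inter_arith)
qed

lemma integrable_power_scaleR: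
  fixes z :: "real \<Rightarrow> 'a :: {banach, second_countable_topology}"
  assumes z: "integrable (lebesgue_on {a..b}) z"
  shows "integrable (lebesgue_on {a..b}) (\<lambda>u. (u - a) ^ j *\<^sub>R z u)"
proof (rule Bochner_Integration.integrable_bound)
  show "integrable (lebesgue_on {a..b}) (\<lambda>u. (b - a) ^ j *\<^sub>R z u)"
    using z by simp
  show "(\<lambda>u. (u - a) ^ j *\<^sub>R z u) \<in> borel_measurable (lebesgue_on {a..b})"
    by (intro borel_measurable_scaleR borel_measurable_integrable[OF z]
        measurable_restrict_space1 measurable_completion) simp
  show "AE u in lebesgue_on {a..b}. norm ((u - a) ^ j *\<^sub>R z u) \<le> norm ((b - a) ^ j *\<^sub>R z u)"
    by (intro AE_I2) (auto simp: power_abs intro!: mult_right_mono power_mono)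
qed

text \<open>
  Interchanging the order of integration: a point \<open>u\<close> lies in \<open>{s..b}\<close> for the \<open>s\<close> between \<open>a\<close> and
  \<open>u\<close>, and \<open>(s - a) ^ m\<close> integrates to \<open>(u - a) ^ Suc m / Suc m\<close> over them. With \<open>m = 0\<close> and \<open>m = 1\<close>
  this turns the iterated integrals of \<open>z\<close> into integrals of \<open>z\<close> against powers of \<open>u - a\<close>.
  The product measure is formed over \<open>lebesgue_on {a..b}\<close>, which is finite.
\<close>
lemma tail_integral_moment:
  fixes z :: "real \<Rightarrow> 'a :: {banach, second_countable_topology}"
  assumes z: "integrable (lebesgue_on {a..b}) z"
  shows "has_bochner_integral (lebesgue_on {a..b})
           (\<lambda>s. (s - a) ^ m *\<^sub>R (LINT u:{s..b}|lebesgue. z u))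
           ((1 / Suc m) *\<^sub>R (LINT u|lebesgue_on {a..b}. (u - a) ^ Suc m *\<^sub>R z u))"
proof -
  let ?M = "lebesgue_on {a..b}"
  interpret finite_measure ?M
    by (rule finite_measure_lebesgue_on) simp
  interpret pair_sigma_finite ?M ?M ..
  define f where "f u s = (indicator {..u} s * (s - a) ^ m) *\<^sub>R z u" for u s
  have power_int: "has_bochner_integral ?M (\<lambda>s. indicator {..u} s * (s - a) ^ m)
      ((u - a) ^ Suc m / Suc m)" if "u \<in> {a..b}" for u
  proof -
    have "((\<lambda>x. (x - a) ^ Suc m / Suc m) has_real_derivative (x - a) ^ m) (at x)" for x
      by (rule derivative_eq_intros refl | simp)+
    moreover have "continuous_on UNIV (\<lambda>x. (x - a) ^ m)"
      by (intro continuous_intros)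
    ultimately show ?thesis
      using that has_bochner_integral_FTC_upto[of a u b "\<lambda>x. (x - a) ^ Suc m / Suc m" "\<lambda>x. (x - a) ^ m"]
      by simp
  qed
  have f_int: "has_bochner_integral ?M (f u) (((u - a) ^ Suc m / Suc m) *\<^sub>R z u)"
    if "u \<in> {a..b}" for u
    unfolding f_def by (intro has_bochner_integral_scaleR_left power_int that)
  have norm_f_int: "(LINT s|?M. norm (f u s)) = (1 / Suc m) * norm ((u - a) ^ Suc m *\<^sub>R z u)"
    if "u \<in> {a..b}" for u
  proof -
    have "(LINT s|?M. norm (f u s)) = (LINT s|?M. (indicator {..u} s * (s - a) ^ m) *\<^sub>R norm (z u))"
      by (intro Bochner_Integration.integral_cong) (auto simp: f_def abs_mult)
    also have "\<dots> = ((u - a) ^ Suc m / Suc m) *\<^sub>R norm (z u)"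
      by (intro has_bochner_integral_integral_eq has_bochner_integral_scaleR_left power_int that)
    finally show ?thesis
      using that by (simp add: abs_mult power_abs)
  qed
  have meas: "case_prod f \<in> borel_measurable (?M \<Otimes>\<^sub>M ?M)"
  proof -
    have id: "(\<lambda>x. x) \<in> borel_measurable ?M"
      by (intro measurable_restrict_space1 measurable_completion) simp
    have [measurable]: "fst \<in> borel_measurable (?M \<Otimes>\<^sub>M ?M)" "snd \<in> borel_measurable (?M \<Otimes>\<^sub>M ?M)"
      using measurable_compose[OF measurable_fst id] measurable_compose[OF measurable_snd id] by auto
    have [measurable]: "(\<lambda>p. z (fst p)) \<in> borel_measurable (?M \<Otimes>\<^sub>M ?M)"
      using measurable_compose[OF measurable_fst borel_measurable_integrable[OF z]] .
    have "case_prod f = (\<lambda>p. if snd p \<le> fst p then (snd p - a) ^ m *\<^sub>R z (fst p) else 0)"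
      by (auto simp: f_def fun_eq_iff)
    then show ?thesis
      by simp
  qed
  have prod: "integrable (?M \<Otimes>\<^sub>M ?M) (case_prod f)"
  proof (rule Fubini_integrable[OF meas])
    have "integrable ?M (\<lambda>u. (1 / Suc m) * norm ((u - a) ^ Suc m *\<^sub>R z u))"
      by (intro integrable_mult_right integrable_norm integrable_power_scaleR z)
    then show "integrable ?M (\<lambda>u. LINT s|?M. norm (case (u, s) of (u, s) \<Rightarrow> f u s))"
      by (subst Bochner_Integration.integrable_cong[OF refl]) (simp_all only: prod.case norm_f_int space_lebesgue_on)
    show "AE u in ?M. integrable ?M (\<lambda>s. case (u, s) of (u, s) \<Rightarrow> f u s)"
      using f_int by (intro AE_I2) (auto simp: has_bochner_integral_iff)
  qed
  have inner: "(LINT u|?M. f u s) = (s - a) ^ m *\<^sub>R (LINT u:{s..b}|lebesgue. z u)"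
    if "s \<in> {a..b}" for s
  proof -
    have "(LINT u|?M. f u s) = (LINT u|?M. (s - a) ^ m *\<^sub>R indicator {s..} u *\<^sub>R z u)"
      by (intro Bochner_Integration.integral_cong) (auto simp: f_def split: split_indicator)
    also have "\<dots> = (s - a) ^ m *\<^sub>R (LINT u:{s..b}|lebesgue. z u)"
    proof (intro has_bochner_integral_integral_eq has_bochner_integral_scaleR_right)
      show "has_bochner_integral ?M (\<lambda>u. indicator {s..} u *\<^sub>R z u) (LINT u:{s..b}|lebesgue. z u)"
        using has_bochner_integral_lebesgue_on_indicator[OF _ _ z, of "{s..}"] that by (simp add: max_absorb2)
    qed
    finally show ?thesis .
  qed
  have "(LINT s|?M. LINT u|?M. f u s) = (LINT u|?M. LINT s|?M. f u s)"
    by (rule Fubini_integral[OF prod])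
  also have "\<dots> = (LINT u|?M. (1 / Suc m) *\<^sub>R (u - a) ^ Suc m *\<^sub>R z u)"
    using f_int by (intro Bochner_Integration.integral_cong refl) (simp add: has_bochner_integral_iff)
  finally have "(LINT s|?M. LINT u|?M. f u s)
      = (1 / Suc m) *\<^sub>R (LINT u|?M. (u - a) ^ Suc m *\<^sub>R z u)"
    by (simp only: integral_scaleR_right)
  then have "has_bochner_integral ?M (\<lambda>s. LINT u|?M. f u s)
      ((1 / Suc m) *\<^sub>R (LINT u|?M. (u - a) ^ Suc m *\<^sub>R z u))"
    using integrable_snd[OF prod] by (simp add: has_bochner_integral_iff)
  then show "has_bochner_integral ?M (\<lambda>s. (s - a) ^ m *\<^sub>R (LINT u:{s..b}|lebesgue. z u))
           ((1 / Suc m) *\<^sub>R (LINT u|?M. (u - a) ^ Suc m *\<^sub>R z u))"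
    by (rule has_bochner_integral_cong[THEN iffD1, rotated 3]) (auto simp: inner)
qed

section \<open>The constants in terms of moments of the weight\<close>

text \<open>
  The integral of \<open>(u - a) ^ j * exp (- 2 * k * (u - b))\<close> over \<open>{a..t}\<close>, in the form that
  integration by parts produces: the \<open>Suc\<close> equation is the step that lowers the power.
\<close>
primrec weight_moment :: "real \<Rightarrow> real \<Rightarrow> real \<Rightarrow> real \<Rightarrow> nat \<Rightarrow> real" where
  "weight_moment a b k t 0 = (expw a b k - exp (- 2 * k * (t - b))) / (2 * k)"
| "weight_moment a b k t (Suc j) =
     (Suc j * weight_moment a b k t j - (t - a) ^ Suc j * exp (- 2 * k * (t - b))) / (2 * k)"

lemma has_bochner_integral_weight_moment:
  assumes "a \<le> t" "t \<le> b" "0 < k"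
  shows "has_bochner_integral (lebesgue_on {a..b})
           (\<lambda>u. indicator {..t} u * ((u - a) ^ j * exp (- 2 * k * (u - b)))) (weight_moment a b k t j)"
proof (induction j)
  case 0
  have "((\<lambda>u. - exp (- 2 * k * (u - b)) / (2 * k)) has_real_derivative exp (- 2 * k * (u - b))) (at u)" for u
    using \<open>0 < k\<close> by (auto intro!: derivative_eq_intros)
  then have "has_bochner_integral (lebesgue_on {a..b})
      (\<lambda>u. indicator {..t} u * exp (- 2 * k * (u - b)))
      (- exp (- 2 * k * (t - b)) / (2 * k) - (- exp (- 2 * k * (a - b)) / (2 * k)))"
    using assms by (intro has_bochner_integral_FTC_upto) (auto intro!: continuous_intros)
  moreover have "exp (- 2 * k * (a - b)) = expw a b k"
    by (simp add: expw_def algebra_simps)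
  ultimately show ?case
    by (simp add: diff_divide_distrib)
next
  case (Suc j)
  have "((\<lambda>u. - ((u - a) ^ Suc j * exp (- 2 * k * (u - b))) / (2 * k)) has_real_derivative
      (u - a) ^ Suc j * exp (- 2 * k * (u - b))
        - Suc j / (2 * k) * ((u - a) ^ j * exp (- 2 * k * (u - b)))) (at u)" for u
    using \<open>0 < k\<close> by (auto intro!: derivative_eq_intros simp: field_simps simp del: power_Suc)
  then have "has_bochner_integral (lebesgue_on {a..b})
      (\<lambda>u. indicator {..t} u * ((u - a) ^ Suc j * exp (- 2 * k * (u - b))
        - Suc j / (2 * k) * ((u - a) ^ j * exp (- 2 * k * (u - b)))))
      (- ((t - a) ^ Suc j * exp (- 2 * k * (t - b))) / (2 * k)
        - (- ((a - a) ^ Suc j * exp (- 2 * k * (a - b))) / (2 * k)))"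
    using assms by (intro has_bochner_integral_FTC_upto) (auto intro!: continuous_intros)
  from has_bochner_integral_add[OF this has_bochner_integral_mult_right[OF Suc, of "Suc j / (2 * k)"]]
  show ?case
    by (rule has_bochner_integral_cong[THEN iffD1, rotated 3])
       (simp_all add: algebra_simps diff_divide_distrib add_divide_distrib)
qed

text \<open>
  With \<open>x = k (b - a)\<close>, the sign of \<open>q1\<close> is that of \<open>sinh x - x\<close>, up to positive factors.
  Positivity is what makes the division by \<open>q1\<close> hidden in \<open>c2\<close> meaningful.
\<close>
lemma q1_pos:
  assumes "a < b" "0 < k"
  shows "0 < q1 a b k"
proof -
  define x where "x = k * (b - a)"
  have "0 < x"
    using assms by (simp add: x_def)
  \<comment> \<open>\<open>sinh y - y\<close> grows because its derivative is a multiple of \<open>sinh\<^sup>2 (y / 2)\<close>.\<close>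
  have "2 * (0::real) - (exp 0 - exp (- 0)) > 2 * x - (exp x - exp (- x))"
  proof (rule DERIV_neg_imp_decreasing_open[OF \<open>0 < x\<close>])
    fix y :: real assume "0 < y"
    have "0 < (exp (y / 2) - exp (- (y / 2)))\<^sup>2"
      using \<open>0 < y\<close> by simp
    also have "\<dots> = exp y + exp (- y) - 2"
      by (simp add: power2_diff flip: exp_of_nat_mult exp_add)
    finally have "2 - (exp y + exp (- y)) < 0"
      by simp
    moreover have "((\<lambda>y. 2 * y - (exp y - exp (- y))) has_real_derivative 2 - (exp y + exp (- y))) (at y)"
      by (auto intro!: derivative_eq_intros)
    ultimately show "\<exists>d. ((\<lambda>y. 2 * y - (exp y - exp (- y))) has_real_derivative d) (at y) \<and> d < 0"
      by blast
  qed (intro continuous_intros)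
  then have "2 * x < exp x - exp (- x)"
    by simp
  then have "(2 * x)\<^sup>2 < (exp x - exp (- x))\<^sup>2"
    using \<open>0 < x\<close> by (intro power_strict_mono) auto
  then have "(2 * x)\<^sup>2 * (exp x)\<^sup>2 < (exp x - exp (- x))\<^sup>2 * (exp x)\<^sup>2"
    by simp
  also have "\<dots> = ((exp x)\<^sup>2 - 1)\<^sup>2"
    by (simp add: field_simps power2_eq_square exp_minus)
  also have "(exp x)\<^sup>2 = expw a b k"
    by (simp add: expw_def x_def mult.assoc flip: exp_of_nat_mult exp_double)
  finally have *: "(2 * x)\<^sup>2 * expw a b k < (expw a b k - 1)\<^sup>2" .
  have "1 < expw a b k"
    using assms by (simp add: expw_def)
  then have "q1 a b k = ((expw a b k - 1)\<^sup>2 - (2 * x)\<^sup>2 * expw a b k) / (8 * k ^ 3 * (expw a b k - 1))"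
    using \<open>0 < k\<close> by (simp add: q1_def Let_def x_def field_simps power2_eq_square power3_eq_cube)
  also have "\<dots> > 0"
    using * \<open>1 < expw a b k\<close> \<open>0 < k\<close> by (intro divide_pos_pos mult_pos_pos) auto
  finally show ?thesis .
qed

text \<open>
  The explicit constants are expressed through the moments \<open>m j\<close> over \<open>[a, b]\<close> and \<open>n j\<close> over
  \<open>[a, \<xi>]\<close>. In that form they are exactly the Gram--Schmidt coefficients and squared norms, and
  everything further is polynomial algebra in the moments.
\<close>
context
  fixes a b k \<xi> v L :: real and m n :: "nat \<Rightarrow> real"
  assumes ab: "a < b" and k: "0 < k"
  defines "m \<equiv> weight_moment a b k b" and "n \<equiv> weight_moment a b k \<xi>"
    and "v \<equiv> expw a b k - 1" and "L \<equiv> b - a"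
begin

lemma v_pos: "0 < v"
  using ab k by (simp add: v_def expw_def)

lemma moment_recursion:
  shows "m 0 = v / (2 * k)"
    and "m (Suc 0) = (m 0 - L) / (2 * k)"
    and "m 2 = (2 * m (Suc 0) - L ^ 2) / (2 * k)"
    and "m 3 = (3 * m 2 - L ^ 3) / (2 * k)"
    and "m 4 = (4 * m 3 - L ^ 4) / (2 * k)"
  by (simp_all add: m_def v_def L_def eval_nat_numeral)

lemma moment_values:
  shows "m (Suc 0) = (v - 2 * k * L) / (4 * k ^ 2)"
    and "m 2 = (v - 2 * k * L - 2 * k ^ 2 * L ^ 2) / (4 * k ^ 3)"
    and "m 3 = (3 * v - 6 * k * L - 6 * k ^ 2 * L ^ 2 - 4 * k ^ 3 * L ^ 3) / (8 * k ^ 4)"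
    and "m 4 = (3 * v - 6 * k * L - 6 * k ^ 2 * L ^ 2 - 4 * k ^ 3 * L ^ 3 - 2 * k ^ 4 * L ^ 4) / (4 * k ^ 5)"
proof -
  show 1: "m (Suc 0) = (v - 2 * k * L) / (4 * k ^ 2)"
    using k unfolding moment_recursion by (simp add: field_simps power2_eq_square)
  show 2: "m 2 = (v - 2 * k * L - 2 * k ^ 2 * L ^ 2) / (4 * k ^ 3)"
    unfolding moment_recursion(3) 1 using k by (simp add: field_simps eval_nat_numeral)
  show 3: "m 3 = (3 * v - 6 * k * L - 6 * k ^ 2 * L ^ 2 - 4 * k ^ 3 * L ^ 3) / (8 * k ^ 4)"
    unfolding moment_recursion(4) 2 using k by (simp add: field_simps eval_nat_numeral)
  show "m 4 = (3 * v - 6 * k * L - 6 * k ^ 2 * L ^ 2 - 4 * k ^ 3 * L ^ 3 - 2 * k ^ 4 * L ^ 4) / (4 * k ^ 5)"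
    unfolding moment_recursion(5) 3 using k by (simp add: field_simps eval_nat_numeral)
qed

lemma q0_eq: "q0 a b k = m 0"
  by (simp add: q0_def moment_recursion v_def Let_def)

lemma c1_conv: "c1 a b k = L / v - 1 / (2 * k)"
  by (simp add: c1_def Let_def v_def L_def)

text \<open>The function \<open>u - a + c1\<close> is orthogonal to the constants.\<close>
lemma c1_eq: "c1 a b k * m 0 = - m (Suc 0)"
  unfolding c1_conv moment_values moment_recursion(1) using k v_pos
  by (simp add: field_simps power2_eq_square)

lemma q1_eq: "q1 a b k = m 2 + c1 a b k * m (Suc 0)"
proof -
  have "q1 a b k = v / (8 * k ^ 3) - L ^ 2 / (2 * k) - L ^ 2 / (2 * k * v)"
    by (simp add: q1_def Let_def v_def L_def)
  also have "\<dots> = m 2 + c1 a b k * m (Suc 0)"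
    unfolding c1_conv moment_values using k v_pos by (simp add: field_simps eval_nat_numeral)
  finally show ?thesis .
qed

text \<open>
  The coefficient \<open>- c2\<close> is that of the orthogonal projection of \<open>(u - a)\<^sup>2\<close> to \<open>u - a + c1\<close>: the
  right-hand side is minus the inner product of the two functions, and \<open>q1\<close> is the squared norm of the
  latter.
\<close>
lemma c2_eq: "c2 a b k * q1 a b k = - (m 3 + c1 a b k * m 2)"
proof -
  define D where "D = v / (4 * k ^ 2) - L ^ 2 - L ^ 2 / v"
  define N where "N = v / (2 * k ^ 3) - L ^ 3 - L ^ 2 / k - L / (2 * k ^ 2) - L ^ 3 / v - L ^ 2 / (k * v)"
  have "q1 a b k = D / (2 * k)"
    using k v_pos
    by (simp add: q1_def Let_def D_def flip: v_def L_def) (simp add: field_simps eval_nat_numeral)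
  moreover have "D \<noteq> 0"
    using q1_pos[OF ab k] calculation by auto
  moreover have "c2 a b k = - (N / D)"
    by (simp add: c2_def Let_def D_def N_def flip: v_def L_def)
  moreover have "N / (2 * k) = m 3 + c1 a b k * m 2"
    unfolding N_def c1_conv moment_values using k v_pos
    by (simp add: field_simps eval_nat_numeral)
  ultimately show ?thesis
    using k by simp
qed

text \<open>Likewise \<open>c3 - c1 c2\<close> is minus the weighted mean of \<open>(u - a)\<^sup>2\<close>.\<close>
lemma c3_eq: "(c3 a b k - c1 a b k * c2 a b k) * m 0 = - m 2"
proof -
  have *: "c3 a b k - c1 a b k * c2 a b k = - (1 / (2 * k ^ 2) - L ^ 2 / v - L / (k * v))"
    by (simp add: c3_def Let_def v_def L_def)
  show ?thesis
    unfolding * moment_values moment_recursion(1) using k v_pos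
    by (simp add: field_simps eval_nat_numeral)
qed

text \<open>The function \<open>(u - a)\<^sup>2 + c2 (u - a) + c3\<close> is orthogonal to \<open>1\<close> and to \<open>u - a\<close>.\<close>
lemma orthogonality_p2:
  shows "m 2 + c2 a b k * m (Suc 0) + c3 a b k * m 0 = 0"
    and "m 3 + c2 a b k * m 2 + c3 a b k * m (Suc 0) = 0"
proof -
  show *: "m 2 + c2 a b k * m (Suc 0) + c3 a b k * m 0 = 0"
    using c1_eq c3_eq by algebra
  have "m 0 \<noteq> 0"
    using k v_pos by (simp add: moment_recursion)
  moreover have "m 0 * (m 3 + c2 a b k * m 2 + c3 a b k * m (Suc 0)) = 0"
    using c1_eq c3_eq c2_eq q1_eq by algebra
  ultimately show "m 3 + c2 a b k * m 2 + c3 a b k * m (Suc 0) = 0"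
    by simp
qed

text \<open>
  The definition of \<open>q2\<close> is Pythagoras: the squared norm \<open>m 4\<close> of \<open>(u - a)\<^sup>2\<close> minus the squared norms of
  its projections to \<open>u - a + c1\<close> and to \<open>1\<close>.
\<close>
lemma q2_eq: "q2 a b k = m 4 + c2 a b k * m 3 + c3 a b k * m 2"
proof -
  have "q2 a b k = (3 * v / (4 * k ^ 5) - L ^ 4 / (2 * k) - L ^ 3 / k ^ 2 - 3 * L ^ 2 / (2 * k ^ 3)
      - 3 * L / (2 * k ^ 4)) - (c2 a b k)\<^sup>2 * q1 a b k - (c3 a b k - c1 a b k * c2 a b k)\<^sup>2 * m 0"
    by (simp add: q2_def q0_eq Let_def v_def L_def)
  also have "3 * v / (4 * k ^ 5) - L ^ 4 / (2 * k) - L ^ 3 / k ^ 2 - 3 * L ^ 2 / (2 * k ^ 3)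
      - 3 * L / (2 * k ^ 4) = m 4"
    unfolding moment_values using k by (simp add: field_simps eval_nat_numeral)
  finally have "q2 a b k = m 4 - (c2 a b k)\<^sup>2 * q1 a b k - (c3 a b k - c1 a b k * c2 a b k)\<^sup>2 * m 0" .
  then show ?thesis
    using c3_eq c2_eq by algebra
qed

context
  assumes \<xi>: "a < \<xi>" "\<xi> < b"
begin

lemma weight_at_xi_less: "exp (- 2 * k * (\<xi> - b)) < expw a b k"
  using \<xi> k by (simp add: expw_def algebra_simps)

lemma xi_moment_recursion:
  shows "n 0 = (expw a b k - exp (- 2 * k * (\<xi> - b))) / (2 * k)"
    and "n (Suc 0) = (n 0 - (\<xi> - a) * exp (- 2 * k * (\<xi> - b))) / (2 * k)"
  by (simp_all add: n_def)

text \<open>The step function \<open>1 + c4 * indicator {..\<xi>}\<close> has weighted mean zero.\<close>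
lemma c4_eq: "c4 a b k \<xi> * n 0 = - m 0"
  using k weight_at_xi_less by (simp add: c4_def xi_moment_recursion moment_recursion(1) v_def Let_def field_simps)

lemma q3_eq: "q3 a b k \<xi> = - m 0 * (1 + c4 a b k \<xi>)"
  using k weight_at_xi_less by (simp add: c4_def q3_def moment_recursion(1) v_def Let_def field_simps)

text \<open>So \<open>q13\<close> is the inner product of the step function with \<open>u - a + c1\<close>.\<close>
lemma q13_eq: "q13 a b k \<xi> = c4 a b k \<xi> * (n (Suc 0) + c1 a b k * n 0)"
proof -
  have "q13 a b k \<xi> = - c4 a b k \<xi> * (\<xi> - a) * exp (- 2 * k * (\<xi> - b)) / (2 * k) - L / (2 * k)"
    by (simp add: q13_def c4_def Let_def L_def mult.commute)
  moreover have "L / (2 * k) = m 0 / (2 * k) - m (Suc 0)"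
    by (simp add: moment_recursion(2) diff_divide_distrib)
  moreover have "c4 a b k \<xi> * n (Suc 0)
      = (c4 a b k \<xi> * n 0 - c4 a b k \<xi> * (\<xi> - a) * exp (- 2 * k * (\<xi> - b))) / (2 * k)"
    by (simp add: xi_moment_recursion algebra_simps)
  moreover have "c4 a b k \<xi> * (c1 a b k * n 0) = m (Suc 0)"
    using c4_eq c1_eq by algebra
  ultimately show ?thesis
    by (simp add: c4_eq distrib_left diff_divide_distrib)
qed

end
end

section \<open>The orthogonal system\<close>

text \<open>
  All functions involved are combinations of \<open>1\<close>, \<open>u - a\<close>, \<open>(u - a)\<^sup>2\<close> and one step at \<open>\<xi>\<close>; the
  coefficients are listed from the quadratic term down, followed by the height of the step.
\<close>
fun trial :: "real \<Rightarrow> real \<Rightarrow> real \<times> real \<times> real \<times> real \<Rightarrow> real \<Rightarrow> real" where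
  "trial a \<xi> (\<alpha>, \<beta>, \<gamma>, \<delta>) u = \<alpha> * (u - a)\<^sup>2 + \<beta> * (u - a) + \<gamma> + \<delta> * indicator {..\<xi>} u"

text \<open>
  The inner product of two such functions, with weight \<open>exp (- 2 * k * (u - b))\<close> on \<open>{a..b}\<close>. A step
  restricts the integration to \<open>{a..\<xi>}\<close>, and the product of two steps is again one step, so every
  term is a moment up to \<open>b\<close> or up to \<open>\<xi>\<close>.
\<close>
fun trial_gram :: "real \<Rightarrow> real \<Rightarrow> real \<Rightarrow> real \<Rightarrow>
    real \<times> real \<times> real \<times> real \<Rightarrow> real \<times> real \<times> real \<times> real \<Rightarrow> real" where
  "trial_gram a b k \<xi> (\<alpha>, \<beta>, \<gamma>, \<delta>) (\<alpha>', \<beta>', \<gamma>', \<delta>') =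
    (let m = weight_moment a b k b; n = weight_moment a b k \<xi> in
      \<alpha> * \<alpha>' * m 4 + (\<alpha> * \<beta>' + \<beta> * \<alpha>') * m 3 + (\<alpha> * \<gamma>' + \<beta> * \<beta>' + \<gamma> * \<alpha>') * m 2
      + (\<beta> * \<gamma>' + \<gamma> * \<beta>') * m 1 + \<gamma> * \<gamma>' * m 0
      + (\<delta> * \<alpha>' + \<alpha> * \<delta>') * n 2 + (\<delta> * \<beta>' + \<beta> * \<delta>') * n 1
      + (\<delta> * \<gamma>' + \<gamma> * \<delta>' + \<delta> * \<delta>') * n 0)"

lemma has_bochner_integral_trial_gram:
  assumes "a < \<xi>" "\<xi> < b" "0 < k"
  shows "has_bochner_integral (lebesgue_on {a..b})
      (\<lambda>u. trial a \<xi> c u * trial a \<xi> d u * exp (- 2 * k * (u - b))) (trial_gram a b k \<xi> c d)"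
proof -
  obtain \<alpha> \<beta> \<gamma> \<delta> where c: "c = (\<alpha>, \<beta>, \<gamma>, \<delta>)"
    by (cases c)
  obtain \<alpha>' \<beta>' \<gamma>' \<delta>' where d: "d = (\<alpha>', \<beta>', \<gamma>', \<delta>')"
    by (cases d)
  define w where "w t j u = indicator {..t} u * ((u - a) ^ j * exp (- 2 * k * (u - b)))"
    for t :: real and j :: nat and u
  have m: "has_bochner_integral (lebesgue_on {a..b}) (w b j) (weight_moment a b k b j)" for j
    unfolding w_def using assms by (intro has_bochner_integral_weight_moment) auto
  have n: "has_bochner_integral (lebesgue_on {a..b}) (w \<xi> j) (weight_moment a b k \<xi> j)" for j
    unfolding w_def using assms by (intro has_bochner_integral_weight_moment) auto
  have "has_bochner_integral (lebesgue_on {a..b})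
      (\<lambda>u. \<alpha> * \<alpha>' * w b 4 u + (\<alpha> * \<beta>' + \<beta> * \<alpha>') * w b 3 u + (\<alpha> * \<gamma>' + \<beta> * \<beta>' + \<gamma> * \<alpha>') * w b 2 u
      + (\<beta> * \<gamma>' + \<gamma> * \<beta>') * w b 1 u + \<gamma> * \<gamma>' * w b 0 u
      + (\<delta> * \<alpha>' + \<alpha> * \<delta>') * w \<xi> 2 u + (\<delta> * \<beta>' + \<beta> * \<delta>') * w \<xi> 1 u
      + (\<delta> * \<gamma>' + \<gamma> * \<delta>' + \<delta> * \<delta>') * w \<xi> 0 u) (trial_gram a b k \<xi> c d)"
    unfolding c d trial_gram.simps Let_def
    by (intro has_bochner_integral_add has_bochner_integral_mult_right m n)
  then show ?thesis
  proof (rule has_bochner_integral_cong[THEN iffD1, rotated 3])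
    fix u assume "u \<in> space (lebesgue_on {a..b})"
    then have "indicator {..b} u = (1 :: real)"
      by simp
    then show "\<alpha> * \<alpha>' * w b 4 u + (\<alpha> * \<beta>' + \<beta> * \<alpha>') * w b 3 u + (\<alpha> * \<gamma>' + \<beta> * \<beta>' + \<gamma> * \<alpha>') * w b 2 u
      + (\<beta> * \<gamma>' + \<gamma> * \<beta>') * w b 1 u + \<gamma> * \<gamma>' * w b 0 u
      + (\<delta> * \<alpha>' + \<alpha> * \<delta>') * w \<xi> 2 u + (\<delta> * \<beta>' + \<beta> * \<delta>') * w \<xi> 1 u
      + (\<delta> * \<gamma>' + \<gamma> * \<delta>' + \<delta> * \<delta>') * w \<xi> 0 u
      = trial a \<xi> c u * trial a \<xi> d u * exp (- 2 * k * (u - b))"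
      unfolding w_def c d by (cases "u \<le> \<xi>") (simp_all add: eval_nat_numeral algebra_simps)
  qed simp_all
qed

text \<open>
  For the triple integral, the order of integration is interchanged twice: first for the tail integral
  \<open>Z\<close> of \<open>z\<close>, which gives the integral of \<open>(u - a) Z u\<close>, then for \<open>z\<close> itself. The second step contributes
  the factor \<open>1 / 2\<close> that the \<open>2\<close> cancels.
\<close>
lemma has_bochner_integral_trial:
  fixes z :: "real \<Rightarrow> 'a :: {banach, second_countable_topology}"
  assumes "a < \<xi>" "\<xi> < b" and z: "integrable (lebesgue_on {a..b}) z"
  shows "has_bochner_integral (lebesgue_on {a..b}) (\<lambda>u. trial a \<xi> (\<alpha>, \<beta>, \<gamma>, \<delta>) u *\<^sub>R z u)
      (\<alpha> *\<^sub>R 2 *\<^sub>R (LINT s:{a..b}|lebesgue. (LINT u:{s..b}|lebesgue. (LINT v:{u..b}|lebesgue. z v)))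
       + \<beta> *\<^sub>R (LINT s:{a..b}|lebesgue. (LINT u:{s..b}|lebesgue. z u))
       + \<gamma> *\<^sub>R (LINT u:{a..b}|lebesgue. z u) + \<delta> *\<^sub>R (LINT u:{a..\<xi>}|lebesgue. z u))"
proof -
  let ?M = "lebesgue_on {a..b}"
  define Z where "Z s = (LINT u:{s..b}|lebesgue. z u)" for s
  have M: "(LINT s|?M. h s) = (LINT s:{a..b}|lebesgue. h s)" for h :: "real \<Rightarrow> 'a"
    by (simp add: integral_restrict_space set_lebesgue_integral_def)
  have Z: "integrable ?M Z"
    using tail_integral_moment[OF z, of 0] by (simp add: has_bochner_integral_iff Z_def[abs_def])
  have Z0: "(LINT s:{a..b}|lebesgue. Z s) = (LINT u|?M. (u - a) *\<^sub>R z u)"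
    using tail_integral_moment[OF z, of 0] by (simp add: has_bochner_integral_iff Z_def M)
  have "(LINT s:{a..b}|lebesgue. (LINT u:{s..b}|lebesgue. Z u)) = (LINT u|?M. (u - a) *\<^sub>R Z u)"
    using tail_integral_moment[OF Z, of 0] by (simp add: has_bochner_integral_iff M)
  also have "\<dots> = (1 / 2) *\<^sub>R (LINT u|?M. (u - a)\<^sup>2 *\<^sub>R z u)"
    using tail_integral_moment[OF z, of 1]
    by (simp add: has_bochner_integral_iff Z_def M power2_eq_square)
  finally have Z1: "2 *\<^sub>R (LINT s:{a..b}|lebesgue. (LINT u:{s..b}|lebesgue. Z u)) = (LINT u|?M. (u - a)\<^sup>2 *\<^sub>R z u)"
    by simp
  have P: "has_bochner_integral ?M (\<lambda>u. (u - a) ^ j *\<^sub>R z u) (LINT u|?M. (u - a) ^ j *\<^sub>R z u)" for j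
    using integrable_power_scaleR[OF z, of j] by (simp add: has_bochner_integral_iff)
  have X: "has_bochner_integral ?M (\<lambda>u. indicator {..\<xi>} u *\<^sub>R z u) (LINT u:{a..\<xi>}|lebesgue. z u)"
    using has_bochner_integral_lebesgue_on_indicator[OF _ _ z, of "{..\<xi>}"] \<open>\<xi> < b\<close>
    by (simp add: min_absorb2)
  have "has_bochner_integral ?M (\<lambda>u. \<alpha> *\<^sub>R (u - a) ^ 2 *\<^sub>R z u + \<beta> *\<^sub>R (u - a) ^ 1 *\<^sub>R z u
        + \<gamma> *\<^sub>R (u - a) ^ 0 *\<^sub>R z u + \<delta> *\<^sub>R indicator {..\<xi>} u *\<^sub>R z u)
     (\<alpha> *\<^sub>R (LINT u|?M. (u - a) ^ 2 *\<^sub>R z u) + \<beta> *\<^sub>R (LINT u|?M. (u - a) ^ 1 *\<^sub>R z u)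
        + \<gamma> *\<^sub>R (LINT u|?M. (u - a) ^ 0 *\<^sub>R z u) + \<delta> *\<^sub>R (LINT u:{a..\<xi>}|lebesgue. z u))"
    by (intro has_bochner_integral_add has_bochner_integral_scaleR_right P X)
  then show ?thesis
    by (simp add: Z0[unfolded Z_def] Z1[unfolded Z_def] M scaleR_add_left)
qed

text \<open>
  The defining property of \<open>\<xi>\<close> says that \<open>(u - a)\<^sup>2 + c2 (u - a) + c3\<close> is orthogonal to
  \<open>indicator {..\<xi>}\<close>.
\<close>
lemma xi_moment_relation:
  assumes "a < b" "0 < k" "is_xi a b k \<xi>"
  shows "weight_moment a b k \<xi> 2 + c2 a b k * weight_moment a b k \<xi> 1 + c3 a b k * weight_moment a b k \<xi> 0 = 0"
proof -
  have \<xi>: "a < \<xi>" "\<xi> < b"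
    using assms by (auto simp: is_xi_def)
  have "has_bochner_integral (lebesgue_on {a..b})
      (\<lambda>u. trial a \<xi> (0, 0, 0, 1) u * trial a \<xi> (1, c2 a b k, c3 a b k, 0) u * exp (- 2 * k * (u - b)))
      (trial_gram a b k \<xi> (0, 0, 0, 1) (1, c2 a b k, c3 a b k, 0))"
    by (rule has_bochner_integral_trial_gram[OF \<xi> assms(2)])
  then have "trial_gram a b k \<xi> (0, 0, 0, 1) (1, c2 a b k, c3 a b k, 0)
      = (LINT u|lebesgue_on {a..b}. trial a \<xi> (0, 0, 0, 1) u
          * trial a \<xi> (1, c2 a b k, c3 a b k, 0) u * exp (- 2 * k * (u - b)))"
    by (simp only: has_bochner_integral_iff)
  also have "\<dots> = (LINT u|lebesgue. indicator {a..b} u *\<^sub>R (trial a \<xi> (0, 0, 0, 1) u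
          * trial a \<xi> (1, c2 a b k, c3 a b k, 0) u * exp (- 2 * k * (u - b))))"
    by (rule integral_restrict_space) simp
  also have "\<dots> = (LINT u:{a..\<xi>}|lebesgue.
        ((u - a) ^ 2 + c2 a b k * (u - a) + c3 a b k) * exp (- 2 * k * (u - b)))"
    unfolding set_lebesgue_integral_def
    using \<xi> by (intro Bochner_Integration.integral_cong) (auto split: split_indicator)
  also have "\<dots> = 0"
    using assms by (simp add: is_xi_def)
  finally show ?thesis
    by (simp add: Let_def algebra_simps)
qed

text \<open>
  The last function is the step function \<open>1 + c4 * indicator {..\<xi>}\<close> made orthogonal to
  \<open>u - a + c1\<close>.
\<close>
definition basis_coeffs :: "real \<Rightarrow> real \<Rightarrow> real \<Rightarrow> real \<Rightarrow> nat \<Rightarrow> real \<times> real \<times> real \<times> real" where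
  "basis_coeffs a b k \<xi> i =
    [(0, 0, 1, 0),
     (0, 1, c1 a b k, 0),
     (1, c2 a b k, c3 a b k, 0),
     (0, - (q13 a b k \<xi> / q1 a b k), 1 - q13 a b k \<xi> / q1 a b k * c1 a b k, c4 a b k \<xi>)] ! i"

lemma less_4_cases: "i < (4 :: nat) \<longleftrightarrow> i = 0 \<or> i = 1 \<or> i = 2 \<or> i = 3"
  by auto

lemma trial_gram_commute: "trial_gram a b k \<xi> c d = trial_gram a b k \<xi> d c"
  by (cases c; cases d) (simp add: Let_def algebra_simps)

text \<open>
  The Gram matrix is diagonal. Its last entry falls short of \<open>q3\<close>, the squared norm of
  \<open>1 + c4 * indicator {..\<xi>}\<close>, by the squared norm of the component along \<open>u - a + c1\<close> that was removed.
\<close>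
lemma basis_gram:
  assumes "a < b" "0 < k" "is_xi a b k \<xi>"
  defines "g \<equiv> \<lambda>i j. trial_gram a b k \<xi> (basis_coeffs a b k \<xi> i) (basis_coeffs a b k \<xi> j)"
  shows "i < 4 \<Longrightarrow> j < 4 \<Longrightarrow> i \<noteq> j \<Longrightarrow> g i j = 0"
    and "g 0 0 = q0 a b k" and "g 1 1 = q1 a b k" and "g 2 2 = q2 a b k"
    and "g 3 3 = q3 a b k \<xi> - (q13 a b k \<xi>)\<^sup>2 / q1 a b k"
proof -
  have \<xi>: "a < \<xi>" "\<xi> < b"
    using assms by (auto simp: is_xi_def)
  note ab = assms(1,2)
  define m where "m = weight_moment a b k b"
  define n where "n = weight_moment a b k \<xi>"
  define r where "r = q13 a b k \<xi> / q1 a b k"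
  have q1: "q1 a b k > 0"
    by (rule q1_pos[OF ab])
  then have r: "r * q1 a b k = q13 a b k \<xi>"
    by (simp add: r_def)
  have p: "basis_coeffs a b k \<xi> 0 = (0, 0, 1, 0)"
    "basis_coeffs a b k \<xi> 1 = (0, 1, c1 a b k, 0)"
    "basis_coeffs a b k \<xi> 2 = (1, c2 a b k, c3 a b k, 0)"
    "basis_coeffs a b k \<xi> 3 = (0, - r, 1 - r * c1 a b k, c4 a b k \<xi>)"
    by (simp_all add: basis_coeffs_def r_def)
  note g = g_def p trial_gram.simps Let_def m_def[symmetric] n_def[symmetric]
  note c1 = c1_eq[OF ab, folded m_def One_nat_def]
    and p2 = orthogonality_p2[OF ab, folded m_def One_nat_def]
    and c4 = c4_eq[OF ab \<xi>, folded m_def n_def]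
    and \<xi>_rel = xi_moment_relation[OF assms(1-3), folded n_def]
    and q1_eq = q1_eq[OF ab, folded m_def One_nat_def]
    and q13_eq = q13_eq[OF ab \<xi>, folded n_def One_nat_def]
  have g01: "g 0 1 = 0" unfolding g using c1 by algebra
  have g02: "g 0 2 = 0" unfolding g using p2 by algebra
  have g12: "g 1 2 = 0" unfolding g using p2 by algebra
  have g03: "g 0 3 = 0" unfolding g using c1 c4 by algebra
  have g13: "g 1 3 = 0" unfolding g using c1 q1_eq q13_eq r by algebra
  have g23: "g 2 3 = 0" unfolding g using p2 \<xi>_rel by algebra
  have sym: "g i j = g j i" for i j
    by (simp only: g_def trial_gram_commute)
  show "g 0 0 = q0 a b k"
    unfolding g using q0_eq[OF ab, folded m_def] by simp
  show "g 1 1 = q1 a b k"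
    unfolding g using c1 q1_eq by algebra
  show "g 2 2 = q2 a b k"
    unfolding g using p2 q2_eq[OF ab, folded m_def] by algebra
  have "g 3 3 = q3 a b k \<xi> - r * q13 a b k \<xi>"
    unfolding g using c1 c4 q1_eq q13_eq r q3_eq[OF ab \<xi>, folded m_def] by algebra
  then show "g 3 3 = q3 a b k \<xi> - (q13 a b k \<xi>)\<^sup>2 / q1 a b k"
    by (simp add: r_def power2_eq_square)
  show "i < 4 \<Longrightarrow> j < 4 \<Longrightarrow> i \<noteq> j \<Longrightarrow> g i j = 0"
    using g01 g02 g12 g03 g13 g23 sym unfolding less_4_cases by metis
qed

section \<open>The integral inequality\<close>

theorem lemma2p4:
  fixes a b k \<xi> :: real and z :: "real \<Rightarrow> real ^ 'n" and R :: "real ^ 'n ^ 'n"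
  assumes "a < b" and "k > 0"
    and "set_integrable lebesgue {a..b} z"
    and "sym_pos_def R"
    and "is_xi a b k \<xi>"
  shows "weighted_energy a b k R z \<ge> ennreal (
      1 / q0 a b k * quad R (Omega0 a b z)
    + 1 / q1 a b k * quad R (Omega1 a b k z)
    + 1 / q2 a b k * quad R (Omega2 a b k z)
    + 1 / q3 a b k \<xi> *
        quad R (Omega3 a b k \<xi> z - (q13 a b k \<xi> / q1 a b k) *\<^sub>R Omega1 a b k z))"
proof -
  let ?M = "lebesgue_on {a..b}"
  have \<xi>: "a < \<xi>" "\<xi> < b"
    using assms by (auto simp: is_xi_def)
  have z: "integrable ?M z"
    using assms(3) by (simp add: integrable_restrict_space set_integrable_def)
  define \<Omega> where "\<Omega> i = [Omega0 a b z, Omega1 a b k z, Omega2 a b k z,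
    Omega3 a b k \<xi> z - (q13 a b k \<xi> / q1 a b k) *\<^sub>R Omega1 a b k z] ! i" for i
  define q where "q i = [q0 a b k, q1 a b k, q2 a b k, q3 a b k \<xi>] ! i" for i
  have "ennreal (\<Sum>i<4. 1 / q i * quad R (\<Omega> i))
      \<le> (\<integral>\<^sup>+u. ennreal (quad R (z u) / exp (- 2 * k * (u - b))) \<partial>?M)"
  proof (rule weighted_bessel_inequality[where p = "\<lambda>i. trial a \<xi> (basis_coeffs a b k \<xi> i)"
        and G = "\<lambda>i j. trial_gram a b k \<xi> (basis_coeffs a b k \<xi> i) (basis_coeffs a b k \<xi> j)"])
    fix i :: nat assume i: "i \<in> {..<4}"
    show "has_bochner_integral ?M (\<lambda>u. trial a \<xi> (basis_coeffs a b k \<xi> i) u *\<^sub>R z u) (\<Omega> i)"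
    proof -
      obtain \<alpha> \<beta> \<gamma> \<delta> where c: "basis_coeffs a b k \<xi> i = (\<alpha>, \<beta>, \<gamma>, \<delta>)"
        by (cases "basis_coeffs a b k \<xi> i")
      have "\<Omega> i = \<alpha> *\<^sub>R 2 *\<^sub>R (LINT s:{a..b}|lebesgue. (LINT u:{s..b}|lebesgue. (LINT v:{u..b}|lebesgue. z v)))
       + \<beta> *\<^sub>R (LINT s:{a..b}|lebesgue. (LINT u:{s..b}|lebesgue. z u))
       + \<gamma> *\<^sub>R (LINT u:{a..b}|lebesgue. z u) + \<delta> *\<^sub>R (LINT u:{a..\<xi>}|lebesgue. z u)"
        using c i
        by (auto simp: less_4_cases basis_coeffs_def \<Omega>_def Omega0_def Omega1_def Omega2_def Omega3_def
            scaleR_add_right scaleR_diff_left scaleR_diff_right)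
      then show ?thesis
        using has_bochner_integral_trial[OF \<xi> z, of \<alpha> \<beta> \<gamma> \<delta>] c by simp
    qed
    show "trial_gram a b k \<xi> (basis_coeffs a b k \<xi> i) (basis_coeffs a b k \<xi> i) \<le> q i"
      using i basis_gram(2-5)[OF assms(1,2,5)] q1_pos[OF assms(1,2)]
      by (auto simp: less_4_cases q_def)
  next
    fix i j :: nat assume "i \<in> {..<4}" "j \<in> {..<4}" "i \<noteq> j"
    then show "trial_gram a b k \<xi> (basis_coeffs a b k \<xi> i) (basis_coeffs a b k \<xi> j) = 0"
      using basis_gram(1)[OF assms(1,2,5)] by simp
  next
    fix i j :: nat
    show "has_bochner_integral ?M (\<lambda>u. trial a \<xi> (basis_coeffs a b k \<xi> i) u
        * trial a \<xi> (basis_coeffs a b k \<xi> j) u * exp (- 2 * k * (u - b)))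
        (trial_gram a b k \<xi> (basis_coeffs a b k \<xi> i) (basis_coeffs a b k \<xi> j))"
      by (rule has_bochner_integral_trial_gram[OF \<xi> assms(2)])
  qed (use assms in auto)
  also have "\<dots> = weighted_energy a b k R z"
  proof -
    have "quad R (z u) / exp (- 2 * k * (u - b)) = exp (2 * k * (u - b)) * quad R (z u)" for u
      by (simp add: exp_minus divide_inverse mult.commute)
    then show ?thesis
      by (simp add: weighted_energy_def nn_integral_restrict_space)
  qed
  finally show ?thesis
    by (simp add: q_def \<Omega>_def eval_nat_numeral add.assoc)
qed

end
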